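(* Let $E\subset\mathbb{R}^{N\times n}$ be a compact set and let $U$ be an open and bounded subset of $\mathbb{R}^{N\times n}$ containing $\operatorname{Rco}_f E$. Then $\operatorname{Rco}_f E$ is equal to the set of all $\xi\in\mathbb{R}^{N\times n}$ with the following property: for every $\varepsilon>0$ there exist $I\in\mathbb{N}$ and $(\lambda_i,\xi_i)_{i=1,\dots,I}$ with $\lambda_i>0$, $\sum_{i=1}^I\lambda_i=1$, satisfying $(H_I(U))$, such that $$\xi=\sum_{i=1}^I\lambda_i\xi_i\qquad\text{and}\qquad\sum_{\substack{1\le i\le I\\ \xi_i\notin B_\varepsilon(E)}}\lambda_i<\varepsilon,$$ where $B_\varepsilon(E)=\{\xi\in\mathbb{R}^{N\times n}:\mathrm{dist}(\xi;E)<\varepsilon\}$.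
   Context: A function $f:\mathbb{R}^{N\times n}\to\mathbb{R}$ is rank one convex if $f(\lambda\xi+(1-\lambda)\eta)\le\lambda f(\xi)+(1-\lambda)f(\eta)$ for every $\lambda\in[0,1]$ and every $\xi,\eta$ with $\operatorname{rank}(\xi-\eta)=1$. For $E\subset\mathbb{R}^{N\times n}$, $$\operatorname{Rco}_f E=\{\xi\in\mathbb{R}^{N\times n}: f(\xi)\le 0 \text{ for every rank one convex } f:\mathbb{R}^{N\times n}\to\mathbb{R} \text{ with } f|_E\le 0\}.$$ Property $(H_I(U))$: let $U\subset\mathbb{R}^{N\times n}$ and, for an integer $I\ge1$, let $\xi_i\in\mathbb{R}^{N\times n}$ and $\lambda_i>0$, $i=1,\dots,I$, with $\sum_{i=1}^I\lambda_i=1$. We say that $(\lambda_i,\xi_i)_{1\le i\le I}$ satisfy $(H_I(U))$ if (recursively): (i) in the case $I=1$, $\xi_1\in U$; (ii) in the case $I=2$, $\xi_1,\xi_2\in U$ and $\operatorname{rank}(\xi_1-\xi_2)=1$; (iii) in the case $I>2$, up to a permutation of the indices, $\xi_1,\xi_2\in U$, $\operatorname{rank}(\xi_1-\xi_2)=1$ and, defining $\mu_1=\lambda_1+\lambda_2$, $\eta_1=\frac{\lambda_1\xi_1+\lambda_2\xi_2}{\lambda_1+\lambda_2}$, and $\mu_i=\lambda_{i+1}$, $\eta_i=\xi_{i+1}$ for $2\le i\le I-1$, the family $(\mu_i,\eta_i)_{1\le i\le I-1}$ satisfies $(H_{I-1}(U))$. *)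

theory Defs
  imports "HOL-Analysis.Analysis"
begin

text \<open>The space of real \<open>N \<times> n\<close> matrices is the type \<open>real ^ 'n ^ 'm\<close>, with \<open>N = CARD('m)\<close>
  rows; its \<open>dist\<close> is the one of the Euclidean (Frobenius) norm.\<close>

definition rank_one_convex :: "(real ^ 'n ^ 'm \<Rightarrow> real) \<Rightarrow> bool" where
  "rank_one_convex f \<longleftrightarrow>
    (\<forall>lam\<in>{0..1}. \<forall>\<xi> \<eta>. rank (\<xi> - \<eta>) = 1 \<longrightarrow>
      f (lam *\<^sub>R \<xi> + (1 - lam) *\<^sub>R \<eta>) \<le> lam * f \<xi> + (1 - lam) * f \<eta>)"

definition Rco_f :: "(real ^ 'n ^ 'm) set \<Rightarrow> (real ^ 'n ^ 'm) set" where
  "Rco_f E = {\<xi>. \<forall>f. rank_one_convex f \<and> (\<forall>\<eta>\<in>E. f \<eta> \<le> 0) \<longrightarrow> f \<xi> \<le> 0}"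

text \<open>\<open>satisfies_H I U lam \<xi>\<close> only looks at \<open>lam i\<close> and \<open>\<xi> i\<close> for \<open>1 \<le> i \<le> I\<close>. Positivity and
  normalisation of the weights are not part of the predicate.\<close>

fun satisfies_H ::
    "nat \<Rightarrow> (real ^ 'n ^ 'm) set \<Rightarrow> (nat \<Rightarrow> real) \<Rightarrow> (nat \<Rightarrow> real ^ 'n ^ 'm) \<Rightarrow> bool" where
  "satisfies_H 0 U lam \<xi> \<longleftrightarrow> False"
| "satisfies_H (Suc 0) U lam \<xi> \<longleftrightarrow> \<xi> 1 \<in> U"
| "satisfies_H (Suc (Suc 0)) U lam \<xi> \<longleftrightarrow> \<xi> 1 \<in> U \<and> \<xi> 2 \<in> U \<and> rank (\<xi> 1 - \<xi> 2) = 1"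
| "satisfies_H (Suc (Suc (Suc k))) U lam \<xi> \<longleftrightarrow>
    (\<exists>p. p permutes {1..Suc (Suc (Suc k))} \<and>
      \<xi> (p 1) \<in> U \<and> \<xi> (p 2) \<in> U \<and> rank (\<xi> (p 1) - \<xi> (p 2)) = 1 \<and>
      satisfies_H (Suc (Suc k)) U
        (\<lambda>i. if i = 1 then lam (p 1) + lam (p 2) else lam (p (i + 1)))
        (\<lambda>i. if i = 1
             then (1 / (lam (p 1) + lam (p 2))) *\<^sub>R (lam (p 1) *\<^sub>R \<xi> (p 1) + lam (p 2) *\<^sub>R \<xi> (p 2))
             else \<xi> (p (i + 1))))"

text \<open>The distance to the empty set is infinite by convention, whereas \<open>infdist x {} = 0\<close>; hence
  the condition \<open>E \<noteq> {}\<close>.\<close>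

definition dist_nbhd :: "real \<Rightarrow> ('a :: metric_space) set \<Rightarrow> 'a set" where
  "dist_nbhd \<epsilon> E = {\<xi>. E \<noteq> {} \<and> infdist \<xi> E < \<epsilon>}"

end

theory Submission
  imports Defs
begin

text \<open>Rank one convex functions are convex along the coordinate directions, hence continuous. Jensen's
  inequality along the recursion of \<open>H\<^sub>I(U)\<close> bounds \<open>f \<xi>\<close> by the average of \<open>f\<close> over the family; \<open>f\<close> is
  almost nonpositive near \<open>E\<close> and bounded on \<open>U\<close>, so the approximable \<open>\<xi>\<close> lie in \<open>Rco_f E\<close>.

  Conversely, let \<open>h \<xi>\<close> be the infimum of the average distance to \<open>E\<close> over the families with barycenter
  \<open>\<xi>\<close> obtained by successive rank one splittings inside \<open>U\<close>. It is bounded and rank one convex on \<open>U\<close>, and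
  vanishes on \<open>E\<close>. As the compact set \<open>frontier U\<close> misses \<open>Rco_f E\<close>, some rank one convex \<open>f0\<close> with
  \<open>f0 \<le> 0\<close> on \<open>E\<close> exceeds \<open>h\<close> near the frontier. Then \<open>max h f0\<close>, continued by \<open>f0\<close> outside \<open>U\<close>, is locally
  convex along rank one lines, hence rank one convex on the whole space, and it is \<open>\<le> 0\<close> on \<open>E\<close>. So \<open>h\<close>
  vanishes on \<open>Rco_f E\<close>, and Markov's inequality yields the required families.\<close>

section \<open>Rank one convex functions\<close>

lemma rank_scaleR:
  fixes A :: "real ^ 'n ^ 'm"
  assumes "c \<noteq> 0"
  shows "rank (c *\<^sub>R A) = rank A"
proof -
  have "range (\<lambda>x. (c *\<^sub>R A) *v x) = range (\<lambda>x. A *v x)"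
  proof (intro equalityI subsetI)
    fix y assume "y \<in> range (\<lambda>x. (c *\<^sub>R A) *v x)"
    then obtain x where "y = A *v (c *\<^sub>R x)"
      by (auto simp: scaleR_matrix_vector_assoc matrix_vector_mult_scaleR)
    then show "y \<in> range (\<lambda>x. A *v x)" by blast
  next
    fix y assume "y \<in> range (\<lambda>x. A *v x)"
    then obtain x where "y = (c *\<^sub>R A) *v ((1 / c) *\<^sub>R x)"
      using assms by (auto simp: scaleR_matrix_vector_assoc [symmetric] matrix_vector_mult_scaleR)
    then show "y \<in> range (\<lambda>x. (c *\<^sub>R A) *v x)" by blast
  qed
  then show ?thesis
    by (simp add: rank_dim_range)
qed

lemma rank_minus_commute:
  fixes A B :: "real ^ 'n ^ 'm"
  shows "rank (A - B) = rank (B - A)"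
  using rank_scaleR [of "-1" "A - B"] by simp

text \<open>A coordinate matrix has a single nonzero row, so its row space is a line. This makes
  rank one convexity imply convexity in each matrix entry separately, from which continuity will
  follow.\<close>

lemma rank_Basis:
  fixes b :: "real ^ 'n ^ 'm"
  assumes "b \<in> Basis"
  shows "rank b = 1"
proof -
  obtain i j where b: "b = axis i (axis j 1)"
    using assms by (auto simp: Basis_vec_def)
  have "row k b = (if k = i then axis j 1 else 0)" for k
    by (simp add: b row_def axis_def vec_eq_iff)
  then have "rows b \<subseteq> {0, axis j 1}" "axis j 1 \<in> rows b"
    by (auto simp: rows_def)
  then have "span (rows b) = span {axis j (1::real)}"
    by (metis insert_subset span_insert_0 span_mono subset_antisym empty_subsetI)
  then have "dim (rows b) = dim {axis j (1::real)}"
    by (metis dim_span)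
  also have "\<dots> = 1"
    by (subst dim_eq_card_independent) (auto simp: axis_eq_0_iff)
  finally show ?thesis
    by (simp add: row_rank_def)
qed

lemma rank_one_convexD:
  assumes "rank_one_convex f" "rank (\<xi> - \<eta>) = 1" "0 \<le> t" "t \<le> 1"
  shows "f (t *\<^sub>R \<xi> + (1 - t) *\<^sub>R \<eta>) \<le> t * f \<xi> + (1 - t) * f \<eta>"
  using assms by (auto simp: rank_one_convex_def)

text \<open>Two distinct points of a line with rank one direction differ by a nonzero multiple of
  that direction, again of rank one. Closure properties and locality thus reduce to facts on convex
  functions of one real variable.\<close>

lemma rank_one_convex_iff_convex_on_lines:
  fixes f :: "real ^ 'n ^ 'm \<Rightarrow> real"
  shows "rank_one_convex f \<longleftrightarrow> (\<forall>x u. rank u = 1 \<longrightarrow> convex_on UNIV (\<lambda>t::real. f (x + t *\<^sub>R u)))"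
proof (intro iffI allI impI)
  fix x u :: "real ^ 'n ^ 'm"
  assume f: "rank_one_convex f" and u: "rank u = 1"
  show "convex_on UNIV (\<lambda>t::real. f (x + t *\<^sub>R u))"
  proof (rule convex_on_linorderI)
    fix t r s :: real
    assume t: "0 < t" "t < 1" and "r < s"
    have "(x + s *\<^sub>R u) - (x + r *\<^sub>R u) = (s - r) *\<^sub>R u"
      by (simp add: algebra_simps)
    then have "rank ((x + s *\<^sub>R u) - (x + r *\<^sub>R u)) = 1"
      using \<open>r < s\<close> u by (simp add: rank_scaleR)
    from rank_one_convexD [OF f this, of t] t
    have "f (t *\<^sub>R (x + s *\<^sub>R u) + (1 - t) *\<^sub>R (x + r *\<^sub>R u))
        \<le> t * f (x + s *\<^sub>R u) + (1 - t) * f (x + r *\<^sub>R u)" by simp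
    moreover have "t *\<^sub>R (x + s *\<^sub>R u) + (1 - t) *\<^sub>R (x + r *\<^sub>R u)
        = x + ((1 - t) *\<^sub>R r + t *\<^sub>R s) *\<^sub>R u"
      by (simp add: algebra_simps)
    ultimately show "f (x + ((1 - t) *\<^sub>R r + t *\<^sub>R s) *\<^sub>R u)
        \<le> (1 - t) * f (x + r *\<^sub>R u) + t * f (x + s *\<^sub>R u)"
      by simp
  qed simp
next
  assume lines: "\<forall>x u. rank u = 1 \<longrightarrow> convex_on UNIV (\<lambda>t::real. f (x + t *\<^sub>R u))"
  show "rank_one_convex f"
    unfolding rank_one_convex_def
  proof (intro ballI allI impI)
    fix t :: real and \<xi> \<eta> :: "real ^ 'n ^ 'm"
    assume t: "t \<in> {0..1}" and "rank (\<xi> - \<eta>) = 1"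
    then have "convex_on UNIV (\<lambda>s::real. f (\<eta> + s *\<^sub>R (\<xi> - \<eta>)))"
      using lines by blast
    from convex_onD [OF this, of t 0 1] t
    have "f (\<eta> + t *\<^sub>R (\<xi> - \<eta>)) \<le> (1 - t) * f \<eta> + t * f \<xi>" by simp
    moreover have "\<eta> + t *\<^sub>R (\<xi> - \<eta>) = t *\<^sub>R \<xi> + (1 - t) *\<^sub>R \<eta>"
      by (simp add: algebra_simps)
    ultimately show "f (t *\<^sub>R \<xi> + (1 - t) *\<^sub>R \<eta>) \<le> t * f \<xi> + (1 - t) * f \<eta>"
      by simp
  qed
qed

lemma convex_on_max:
  fixes f g :: "'a::real_vector \<Rightarrow> real"
  assumes "convex_on S f" "convex_on S g"
  shows "convex_on S (\<lambda>x. max (f x) (g x))"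
proof (rule convex_onI)
  fix t :: real and x y
  assume t: "0 < t" "t < 1" and S: "x \<in> S" "y \<in> S"
  have "f ((1 - t) *\<^sub>R x + t *\<^sub>R y) \<le> (1 - t) * f x + t * f y"
    "g ((1 - t) *\<^sub>R x + t *\<^sub>R y) \<le> (1 - t) * g x + t * g y"
    using t S assms by (auto intro: convex_onD)
  moreover have "(1 - t) * f x + t * f y \<le> (1 - t) * max (f x) (g x) + t * max (f y) (g y)"
    "(1 - t) * g x + t * g y \<le> (1 - t) * max (f x) (g x) + t * max (f y) (g y)"
    using t by (auto intro!: add_mono mult_left_mono)
  ultimately show "max (f ((1 - t) *\<^sub>R x + t *\<^sub>R y)) (g ((1 - t) *\<^sub>R x + t *\<^sub>R y))
      \<le> (1 - t) * max (f x) (g x) + t * max (f y) (g y)"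
    by linarith
qed (use assms convex_on_imp_convex in blast)

lemma rank_one_convex_const: "rank_one_convex (\<lambda>_. c)"
  by (simp add: rank_one_convex_def algebra_simps)

lemma rank_one_convex_max:
  "rank_one_convex f \<Longrightarrow> rank_one_convex g \<Longrightarrow> rank_one_convex (\<lambda>x. max (f x) (g x))"
  by (simp add: rank_one_convex_iff_convex_on_lines convex_on_max)

lemma rank_one_convex_cmul:
  "0 \<le> c \<Longrightarrow> rank_one_convex f \<Longrightarrow> rank_one_convex (\<lambda>x. c * f x)"
  by (simp add: rank_one_convex_iff_convex_on_lines convex_on_cmul)

section \<open>Continuity of rank one convex functions\<close>

text \<open>The upper bound is the chord from \<open>0\<close> to whichever of \<open>1\<close> and
  \<open>-1\<close> lies on the side of \<open>t\<close>; the lower one holds because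
  \<open>0\<close> lies between \<open>t\<close> and the opposite endpoint.\<close>

lemma convex_bounds_near_0:
  fixes \<phi> :: "real \<Rightarrow> real"
  assumes \<phi>: "convex_on UNIV \<phi>" and t: "\<bar>t\<bar> \<le> 1"
  shows "\<phi> t \<le> (1 - \<bar>t\<bar>) * \<phi> 0 + \<bar>t\<bar> * max (\<phi> 1) (\<phi> (-1))"
    and "(1 + \<bar>t\<bar>) * \<phi> 0 - \<bar>t\<bar> * max (\<phi> 1) (\<phi> (-1)) \<le> \<phi> t"
proof -
  define e :: real where "e = (if 0 \<le> t then 1 else -1)"
  have e: "\<bar>t\<bar> * e = t" by (simp add: e_def)
  have "\<phi> t \<le> (1 - \<bar>t\<bar>) * \<phi> 0 + \<bar>t\<bar> * \<phi> e"
    using convex_onD [OF \<phi>, of "\<bar>t\<bar>" 0 e] t by (simp add: e)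
  also have "\<bar>t\<bar> * \<phi> e \<le> \<bar>t\<bar> * max (\<phi> 1) (\<phi> (-1))"
    by (rule mult_left_mono) (auto simp: e_def)
  finally show "\<phi> t \<le> (1 - \<bar>t\<bar>) * \<phi> 0 + \<bar>t\<bar> * max (\<phi> 1) (\<phi> (-1))" by simp
  \<comment> \<open>The weight for which \<open>0\<close> equals
    \<open>(1 - r) * t + r * (- e)\<close>. Multiplying by \<open>1 + \<bar>t\<bar>\<close> clears
    the denominators.\<close>
  define r where "r = \<bar>t\<bar> / (1 + \<bar>t\<bar>)"
  have r: "0 \<le> r" "r \<le> 1" "(1 + \<bar>t\<bar>) * r = \<bar>t\<bar>" "(1 + \<bar>t\<bar>) * (1 - r) = 1"
    by (auto simp: r_def field_simps)
  have "(1 + \<bar>t\<bar>) * ((1 - r) * t + r * - e) = ((1 + \<bar>t\<bar>) * (1 - r)) * t - ((1 + \<bar>t\<bar>) * r) * e"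
    by (simp add: algebra_simps)
  also have "\<dots> = 0" by (simp only: r) (simp add: e)
  finally have 0: "(1 - r) * t + r * - e = 0"
    by (smt (verit) mult_eq_0_iff)
  have "\<phi> 0 \<le> (1 - r) * \<phi> t + r * \<phi> (- e)"
    using convex_onD [OF \<phi>, of r t "- e"] r(1,2) 0 by simp
  then have "(1 + \<bar>t\<bar>) * \<phi> 0 \<le> (1 + \<bar>t\<bar>) * ((1 - r) * \<phi> t + r * \<phi> (- e))"
    by (intro mult_left_mono) auto
  also have "\<dots> = ((1 + \<bar>t\<bar>) * (1 - r)) * \<phi> t + ((1 + \<bar>t\<bar>) * r) * \<phi> (- e)"
    by (simp add: algebra_simps)
  also have "\<dots> = \<phi> t + \<bar>t\<bar> * \<phi> (- e)" by (simp only: r mult_1)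
  also have "\<bar>t\<bar> * \<phi> (- e) \<le> \<bar>t\<bar> * max (\<phi> 1) (\<phi> (-1))"
    by (rule mult_left_mono) (auto simp: e_def)
  finally show "(1 + \<bar>t\<bar>) * \<phi> 0 - \<bar>t\<bar> * max (\<phi> 1) (\<phi> (-1)) \<le> \<phi> t" by simp
qed

text \<open>One coordinate \<open>e\<close> is added at a time: along \<open>e\<close>, a convex function is controlled near a point by its
  values at that point and at distance \<open>1\<close> on both sides, and these three values depend continuously
  on the other coordinates by the induction hypothesis.\<close>

lemma separately_convex_imp_isCont:
  fixes f :: "'a::euclidean_space \<Rightarrow> real"
  assumes conv: "\<And>x b. b \<in> Basis \<Longrightarrow> convex_on UNIV (\<lambda>t::real. f (x + t *\<^sub>R b))"
  shows "isCont f x"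
proof -
  \<comment> \<open>The base point stays arbitrary: the induction step uses the hypothesis at
    \<open>x\<close>, \<open>x + e\<close> and \<open>x - e\<close>.\<close>
  have "((\<lambda>y. f (x + (\<Sum>b\<in>S. (y \<bullet> b) *\<^sub>R b))) \<longlongrightarrow> f x) (nhds 0)"
    if "finite S" "S \<subseteq> Basis" for S x
    using that
  proof (induction S arbitrary: x rule: finite_induct)
    case empty
    then show ?case by simp
  next
    case (insert e S)
    define P where "P y = (\<Sum>b\<in>S. (y \<bullet> b) *\<^sub>R b)" for y :: 'a
    let ?M = "\<lambda>y. max (f (x + e + P y)) (f (x - e + P y))"
    have IH: "((\<lambda>y. f (z + P y)) \<longlongrightarrow> f z) (nhds 0)" for z
      unfolding P_def using insert.IH insert.prems by simp
    have id: "((\<lambda>y. y) \<longlongrightarrow> (0::'a)) (nhds 0)"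
      by (simp add: filterlim_def)
    have e0: "((\<lambda>y. \<bar>y \<bullet> e\<bar>) \<longlongrightarrow> \<bar>0 \<bullet> e\<bar>) (nhds 0)"
      by (intro tendsto_intros id)
    then have "\<forall>\<^sub>F y in nhds 0. \<bar>y \<bullet> e\<bar> < 1"
      by (intro order_tendstoD) auto
    then have small: "\<forall>\<^sub>F y in nhds 0. \<bar>y \<bullet> e\<bar> \<le> 1"
      by (rule eventually_mono) simp
    have conv_e: "convex_on UNIV (\<lambda>t::real. f (x + P y + t *\<^sub>R e))" for y
      using conv insert.prems by simp
    have bounds: "f (x + P y + (y \<bullet> e) *\<^sub>R e)
          \<le> (1 - \<bar>y \<bullet> e\<bar>) * f (x + P y) + \<bar>y \<bullet> e\<bar> * ?M y"
      "(1 + \<bar>y \<bullet> e\<bar>) * f (x + P y) - \<bar>y \<bullet> e\<bar> * ?M y \<le> f (x + P y + (y \<bullet> e) *\<^sub>R e)"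
      if "\<bar>y \<bullet> e\<bar> \<le> 1" for y
      using convex_bounds_near_0 [OF conv_e that] by (simp_all add: algebra_simps)
    have "((\<lambda>y. f (x + P y + (y \<bullet> e) *\<^sub>R e)) \<longlongrightarrow> f x) (nhds 0)"
    proof (rule tendsto_sandwich)
      show "\<forall>\<^sub>F y in nhds 0. (1 + \<bar>y \<bullet> e\<bar>) * f (x + P y) - \<bar>y \<bullet> e\<bar> * ?M y
          \<le> f (x + P y + (y \<bullet> e) *\<^sub>R e)"
        using small by (rule eventually_mono) (rule bounds)
      show "\<forall>\<^sub>F y in nhds 0. f (x + P y + (y \<bullet> e) *\<^sub>R e)
          \<le> (1 - \<bar>y \<bullet> e\<bar>) * f (x + P y) + \<bar>y \<bullet> e\<bar> * ?M y"
        using small by (rule eventually_mono) (rule bounds)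
      have "((\<lambda>y. (1 + \<bar>y \<bullet> e\<bar>) * f (x + P y) - \<bar>y \<bullet> e\<bar> * ?M y)
          \<longlongrightarrow> (1 + \<bar>0 \<bullet> e\<bar>) * f x - \<bar>0 \<bullet> e\<bar> * max (f (x + e)) (f (x - e))) (nhds 0)"
        by (intro tendsto_intros IH e0)
      then show "((\<lambda>y. (1 + \<bar>y \<bullet> e\<bar>) * f (x + P y) - \<bar>y \<bullet> e\<bar> * ?M y) \<longlongrightarrow> f x) (nhds 0)"
        by simp
      have "((\<lambda>y. (1 - \<bar>y \<bullet> e\<bar>) * f (x + P y) + \<bar>y \<bullet> e\<bar> * ?M y)
          \<longlongrightarrow> (1 - \<bar>0 \<bullet> e\<bar>) * f x + \<bar>0 \<bullet> e\<bar> * max (f (x + e)) (f (x - e))) (nhds 0)"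
        by (intro tendsto_intros IH e0)
      then show "((\<lambda>y. (1 - \<bar>y \<bullet> e\<bar>) * f (x + P y) + \<bar>y \<bullet> e\<bar> * ?M y) \<longlongrightarrow> f x) (nhds 0)"
        by simp
    qed
    then show ?case
      using insert.hyps by (simp add: P_def algebra_simps)
  qed
  from this [of Basis x] have "((\<lambda>y. f (x + y)) \<longlongrightarrow> f x) (nhds 0)"
    by (simp add: euclidean_representation)
  then have "((\<lambda>y. f (x + y)) \<longlongrightarrow> f x) (at 0)"
    by (rule tendsto_mono [rotated]) (simp add: at_within_def)
  then show ?thesis
    by (simp add: isCont_iff)
qed

lemma rank_one_convex_isCont:
  "rank_one_convex f \<Longrightarrow> isCont f x"
  by (rule separately_convex_imp_isCont) (simp add: rank_one_convex_iff_convex_on_lines rank_Basis)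

lemma rank_one_convex_continuous_on:
  "rank_one_convex f \<Longrightarrow> continuous_on S f"
  by (simp add: continuous_at_imp_continuous_on rank_one_convex_isCont)

section \<open>From local to global convexity on the real line\<close>

text \<open>Subtracting the chord over \<open>{a..b}\<close> gives a function that is still locally
  convex, hence continuous, and vanishes at both ends. It has no positive maximum in between, so the
  original function stays below its chord.\<close>

lemma locally_convex_imp_convex:
  fixes \<phi> :: "real \<Rightarrow> real"
  assumes loc: "\<And>t. \<exists>\<delta>>0. convex_on {t - \<delta><..<t + \<delta>} \<phi>"
  shows "convex_on UNIV \<phi>"
proof (rule convex_on_linorderI)
  fix t a b :: real
  assume t: "0 < t" "t < 1" and ab: "a < b"
  define k where "k = (\<phi> b - \<phi> a) / (b - a)"
  define \<psi> where "\<psi> s = \<phi> s - (\<phi> a + k * (s - a))" for s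
  have ends: "\<psi> a = 0" "\<psi> b = 0"
    using ab by (auto simp: \<psi>_def k_def)
  have loc': "\<exists>\<delta>>0. convex_on {s - \<delta><..<s + \<delta>} \<psi>" for s
  proof -
    obtain \<delta> where "\<delta> > 0" and c: "convex_on {s - \<delta><..<s + \<delta>} \<phi>" using loc by blast
    have "convex_on {s - \<delta><..<s + \<delta>} \<psi>"
    proof (rule convex_onI)
      fix u x y :: real
      assume u: "0 < u" "u < 1" and "x \<in> {s - \<delta><..<s + \<delta>}" "y \<in> {s - \<delta><..<s + \<delta>}"
      then have "\<phi> ((1 - u) *\<^sub>R x + u *\<^sub>R y) \<le> (1 - u) * \<phi> x + u * \<phi> y"
        by (intro convex_onD [OF c]) auto
      moreover have "\<phi> a + k * (((1 - u) *\<^sub>R x + u *\<^sub>R y) - a)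
          = (1 - u) * (\<phi> a + k * (x - a)) + u * (\<phi> a + k * (y - a))"
        unfolding real_scaleR_def by algebra
      moreover have "(1 - u) * \<psi> x + u * \<psi> y = ((1 - u) * \<phi> x + u * \<phi> y)
          - ((1 - u) * (\<phi> a + k * (x - a)) + u * (\<phi> a + k * (y - a)))"
        unfolding \<psi>_def by algebra
      ultimately show "\<psi> ((1 - u) *\<^sub>R x + u *\<^sub>R y) \<le> (1 - u) * \<psi> x + u * \<psi> y"
        unfolding \<psi>_def by linarith
    qed (use c convex_on_imp_convex in blast)
    then show ?thesis using \<open>\<delta> > 0\<close> by blast
  qed
  have cont: "continuous_on UNIV \<psi>"
  proof (rule continuous_at_imp_continuous_on, rule ballI)
    fix s :: real
    obtain \<delta> where \<delta>: "\<delta> > 0" "convex_on {s - \<delta><..<s + \<delta>} \<psi>" using loc' by blast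
    then have "continuous_on {s - \<delta><..<s + \<delta>} \<psi>"
      by (intro convex_on_continuous) auto
    then show "isCont \<psi> s"
      using \<delta> by (auto simp: continuous_on_eq_continuous_at)
  qed
  obtain m where m: "m \<in> {a..b}" "\<And>s. s \<in> {a..b} \<Longrightarrow> \<psi> s \<le> \<psi> m"
    using continuous_attains_sup [of "{a..b}" \<psi>] continuous_on_subset [OF cont] ab by auto
  \<comment> \<open>At the leftmost point of \<open>[a, b]\<close> where \<open>\<psi>\<close> is maximal, local convexity is violated if the maximum is positive.\<close>
  have "\<psi> m \<le> 0"
  proof (rule ccontr)
    assume pos: "\<not> \<psi> m \<le> 0"
    define A where "A = {a..b} \<inter> \<psi> -` {\<psi> m}"
    have "compact A"
      unfolding A_def by (intro compact_Int_closed compact_Icc closed_vimage cont) simp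
    moreover have "m \<in> A" using m by (simp add: A_def)
    ultimately obtain s where s: "s \<in> A" and least: "\<And>r. r \<in> A \<Longrightarrow> s \<le> r"
      using compact_attains_inf [of A] by (metis empty_iff)
    obtain \<delta> where \<delta>: "\<delta> > 0" "convex_on {s - \<delta><..<s + \<delta>} \<psi>" using loc' by blast
    have "a < s" "s < b"
      using s pos ends by (auto simp: A_def less_le)
    \<comment> \<open>Halving \<open>\<delta>\<close> keeps \<open>s - r\<close> and
      \<open>s + r\<close> in the open interval of convexity; the other two terms keep them in
      \<open>{a..b}\<close>.\<close>
    define r where "r = min (\<delta> / 2) (min (s - a) (b - s))"
    have r: "0 < r" "s - r \<in> {a..b}" "s + r \<in> {a..b}" "s - r \<in> {s - \<delta><..<s + \<delta>}"
        "s + r \<in> {s - \<delta><..<s + \<delta>}"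
      using \<open>a < s\<close> \<open>s < b\<close> \<delta>(1) by (auto simp: r_def)
    have "(s - r) + (s + r) = 2 * s" by simp
    then have "\<psi> s \<le> \<psi> (s - r) / 2 + \<psi> (s + r) / 2"
      using convex_onD [OF \<delta>(2) _ _ r(4) r(5), of "1/2"]
      by (simp add: field_simps)
    moreover have "\<psi> (s - r) \<noteq> \<psi> m"
      using least [of "s - r"] r by (auto simp: A_def)
    then have "\<psi> (s - r) < \<psi> m"
      using m(2) [OF r(2)] by simp
    moreover have "\<psi> (s + r) \<le> \<psi> m" "\<psi> s = \<psi> m"
      using m(2) [OF r(3)] s by (auto simp: A_def)
    ultimately show False by simp
  qed
  moreover have "0 \<le> t * (b - a)" "t * (b - a) \<le> 1 * (b - a)"
    using t ab by (auto intro: mult_right_mono)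
  then have "a + t * (b - a) \<in> {a..b}" by simp
  ultimately have "\<psi> (a + t * (b - a)) \<le> 0"
    using m(2) by (meson order_trans)
  moreover have "k * (t * (b - a)) = t * (\<phi> b - \<phi> a)"
    using ab by (simp add: k_def)
  moreover have "a + t * (b - a) = (1 - t) *\<^sub>R a + t *\<^sub>R b"
    by (simp add: algebra_simps)
  ultimately show "\<phi> ((1 - t) *\<^sub>R a + t *\<^sub>R b) \<le> (1 - t) * \<phi> a + t * \<phi> b"
    by (simp add: \<psi>_def algebra_simps)
qed simp

section \<open>Jensen's inequality for rank one families\<close>

text \<open>Follows the recursion of \<open>satisfies_H\<close>: the two terms to be merged come
  first, and the remaining ones carry the index shift \<open>i + 1\<close> of the reduced
  family.\<close>

lemma sum_permute_split_first_two:
  fixes g :: "nat \<Rightarrow> 'a::comm_monoid_add"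
  assumes "p permutes {1..Suc (Suc (Suc k))}"
  shows "(\<Sum>i=1..Suc (Suc (Suc k)). g i) = g (p 1) + g (p 2) + (\<Sum>i=2..Suc (Suc k). g (p (i + 1)))"
proof -
  have "(\<Sum>i=1..Suc (Suc (Suc k)). g i) = (\<Sum>i=1..Suc (Suc (Suc k)). g (p i))"
    using sum.permute [OF assms, of g] by (simp add: comp_def)
  also have "\<dots> = g (p 1) + (g (p 2) + (\<Sum>i=3..Suc (Suc (Suc k)). g (p i)))"
    by (simp add: sum.atLeast_Suc_atMost numeral_2_eq_2 numeral_3_eq_3 del: sum.cl_ivl_Suc)
  also have "(\<Sum>i=3..Suc (Suc (Suc k)). g (p i)) = (\<Sum>i=2..Suc (Suc k). g (p (i + 1)))"
    using sum.shift_bounds_cl_Suc_ivl [of "\<lambda>i. g (p i)" 2 "Suc (Suc k)"]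
    by (simp add: numeral_2_eq_2 numeral_3_eq_3 del: sum.cl_ivl_Suc)
  finally show ?thesis
    by (simp only: add.assoc)
qed

lemma sum_split_first:
  fixes g :: "nat \<Rightarrow> 'a::comm_monoid_add"
  assumes "1 \<le> n"
  shows "(\<Sum>i=1..n. g i) = g 1 + (\<Sum>i=2..n. g i)"
  using assms by (simp add: sum.atLeast_Suc_atMost numeral_2_eq_2)

text \<open>Each recursive clause places two members in \<open>U\<close>; every other member is
  passed on to the reduced family and is reached by induction.\<close>

lemma satisfies_H_mem:
  "satisfies_H I U lam \<xi> \<Longrightarrow> i \<in> {1..I} \<Longrightarrow> \<xi> i \<in> U"
proof (induction I U lam \<xi> arbitrary: i rule: satisfies_H.induct)
  case (2 U lam \<xi>)
  then have "i = 1" by auto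
  with 2 show ?case by simp
next
  case (3 U lam \<xi>)
  then have "i = 1 \<or> i = 2" by auto
  with 3 show ?case by auto
next
  case (4 k U lam \<xi>)
  then obtain p where p: "p permutes {1..Suc (Suc (Suc k))}" "\<xi> (p 1) \<in> U" "\<xi> (p 2) \<in> U"
    and H: "satisfies_H (Suc (Suc k)) U
        (\<lambda>i. if i = 1 then lam (p 1) + lam (p 2) else lam (p (i + 1)))
        (\<lambda>i. if i = 1
             then (1 / (lam (p 1) + lam (p 2))) *\<^sub>R (lam (p 1) *\<^sub>R \<xi> (p 1) + lam (p 2) *\<^sub>R \<xi> (p 2))
             else \<xi> (p (i + 1)))"
    by auto
  obtain j where j: "j \<in> {1..Suc (Suc (Suc k))}" "i = p j"
    using permutes_image [OF p(1)] 4(3) by blast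
  consider "j = 1" | "j = 2" | "j \<ge> 3" using j(1) by fastforce
  then show ?case
  proof cases
    case 3
    then obtain l where l: "j = l + 1" "l \<in> {1..Suc (Suc k)}" "l \<noteq> 1"
      using j(1) by (cases j) auto
    with 4(1) [OF H l(2)] j(2) show ?thesis by simp
  qed (use p j in auto)
qed simp

text \<open>Merging two members keeps the total weight and the barycenter, and it does not increase
  the average of \<open>f\<close>, since the merged point lies on the rank one segment between them.
  Induction then applies to the reduced family.\<close>

lemma satisfies_H_Jensen:
  assumes f: "rank_one_convex f"
  shows "satisfies_H I U lam \<xi> \<Longrightarrow> (\<And>i. i \<in> {1..I} \<Longrightarrow> 0 < lam i) \<Longrightarrow> (\<Sum>i=1..I. lam i) = 1 \<Longrightarrow>
    f (\<Sum>i=1..I. lam i *\<^sub>R \<xi> i) \<le> (\<Sum>i=1..I. lam i * f (\<xi> i))"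
proof (induction I U lam \<xi> rule: satisfies_H.induct)
  case (3 U lam \<xi>)
  have "lam 1 + lam 2 = 1" "0 < lam 1" "0 < lam 2"
    using 3 by (simp_all add: numeral_2_eq_2)
  moreover from this have "lam 2 = 1 - lam 1" by simp
  ultimately have "f (lam 1 *\<^sub>R \<xi> 1 + lam 2 *\<^sub>R \<xi> 2) \<le> lam 1 * f (\<xi> 1) + lam 2 * f (\<xi> 2)"
    using rank_one_convexD [OF f, of "\<xi> 1" "\<xi> 2" "lam 1"] 3(1) by simp
  then show ?case
    by (simp add: numeral_2_eq_2)
next
  case (4 k U lam \<xi>)
  then obtain p where p: "p permutes {1..Suc (Suc (Suc k))}" "rank (\<xi> (p 1) - \<xi> (p 2)) = 1"
    and H: "satisfies_H (Suc (Suc k)) U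
        (\<lambda>i. if i = 1 then lam (p 1) + lam (p 2) else lam (p (i + 1)))
        (\<lambda>i. if i = 1
             then (1 / (lam (p 1) + lam (p 2))) *\<^sub>R (lam (p 1) *\<^sub>R \<xi> (p 1) + lam (p 2) *\<^sub>R \<xi> (p 2))
             else \<xi> (p (i + 1)))" (is "satisfies_H _ _ ?\<mu> ?\<eta>")
    by auto
  have pos: "0 < lam (p j)" if "j \<in> {1..Suc (Suc (Suc k))}" for j
    using 4(3) permutes_in_image [OF p(1)] that by blast
  have pos12: "0 < lam (p 1)" "0 < lam (p 2)"
    by (rule pos, simp)+
  define w where "w = lam (p 1) + lam (p 2)"
  define m where "m = (1 / w) *\<^sub>R (lam (p 1) *\<^sub>R \<xi> (p 1) + lam (p 2) *\<^sub>R \<xi> (p 2))"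
  have w: "w > 0" using pos12 by (simp add: w_def)
  \<comment> \<open>\<open>g\<close> is polymorphic in its result, so that one splitting serves the
    weights, the barycenter and the average of \<open>f\<close>.\<close>
  have split: "(\<Sum>i=1..Suc (Suc k). g (?\<mu> i) (?\<eta> i)) = g w m + (\<Sum>i=2..Suc (Suc k). g (lam (p (i + 1))) (\<xi> (p (i + 1))))"
    for g :: "real \<Rightarrow> real^'a^'b \<Rightarrow> 'c::comm_monoid_add"
    by (subst sum_split_first) (auto simp: w_def m_def intro!: sum.cong)
  have "f (\<Sum>i=1..Suc (Suc k). ?\<mu> i *\<^sub>R ?\<eta> i) \<le> (\<Sum>i=1..Suc (Suc k). ?\<mu> i * f (?\<eta> i))"
  proof (rule 4(1) [OF H])
    show "0 < ?\<mu> i" if "i \<in> {1..Suc (Suc k)}" for i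
      using that pos [of "i + 1"] pos12 by auto
    show "(\<Sum>i=1..Suc (Suc k). ?\<mu> i) = 1"
      unfolding split [of "\<lambda>l x. l"] w_def using sum_permute_split_first_two [OF p(1), of lam] 4(4)
      by simp
  qed
  also have "(\<Sum>i=1..Suc (Suc k). ?\<mu> i *\<^sub>R ?\<eta> i) = (\<Sum>i=1..Suc (Suc (Suc k)). lam i *\<^sub>R \<xi> i)"
    unfolding split [of "\<lambda>l x. l *\<^sub>R x"] sum_permute_split_first_two [OF p(1), of "\<lambda>i. lam i *\<^sub>R \<xi> i"]
    using w by (simp add: m_def)
  also have "(\<Sum>i=1..Suc (Suc k). ?\<mu> i * f (?\<eta> i)) \<le> (\<Sum>i=1..Suc (Suc (Suc k)). lam i * f (\<xi> i))"
  proof -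
    \<comment> \<open>The relative weight of the first merged member, which places \<open>m\<close>
      on the segment.\<close>
    define t where "t = lam (p 1) / w"
    have t: "0 \<le> t" "t \<le> 1" "w * t = lam (p 1)" "w * (1 - t) = lam (p 2)"
      "1 - t = lam (p 2) / w"
      using w pos12 by (auto simp: t_def w_def field_simps)
    have "m = t *\<^sub>R \<xi> (p 1) + (1 - t) *\<^sub>R \<xi> (p 2)"
      unfolding t(5) by (simp add: m_def t_def scaleR_add_right)
    then have "f m \<le> t * f (\<xi> (p 1)) + (1 - t) * f (\<xi> (p 2))"
      using rank_one_convexD [OF f p(2) t(1,2)] by simp
    then have "w * f m \<le> w * (t * f (\<xi> (p 1)) + (1 - t) * f (\<xi> (p 2)))"
      using w by (intro mult_left_mono) auto
    also have "\<dots> = (w * t) * f (\<xi> (p 1)) + (w * (1 - t)) * f (\<xi> (p 2))"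
      by (simp only: distrib_left mult.assoc)
    finally show ?thesis
      unfolding split [of "\<lambda>l x. l * f x"] sum_permute_split_first_two [OF p(1), of "\<lambda>i. lam i * f (\<xi> i)"]
        t(3,4) by simp
  qed
  finally show ?case .
qed simp_all

text \<open>In Jensen's inequality the members near \<open>E\<close> contribute at most
  \<open>\<delta>\<close> in total, by continuity of \<open>f\<close>. The others contribute at most
  an upper bound of \<open>f\<close> on \<open>U\<close> times their total weight, which is
  small.\<close>

lemma rank_one_convex_le_0_of_satisfies_H:
  fixes E U :: "(real ^ 'n ^ 'm) set"
  assumes "compact E" "bounded U" and f: "rank_one_convex f" and E: "\<And>\<eta>. \<eta> \<in> E \<Longrightarrow> f \<eta> \<le> 0"
    and approx: "\<And>\<epsilon>. \<epsilon> > 0 \<Longrightarrow> \<exists>I lam \<xi>s. (\<forall>i\<in>{1..I}. lam i > 0) \<and> (\<Sum>i=1..I. lam i) = 1 \<and>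
        satisfies_H I U lam \<xi>s \<and> \<xi> = (\<Sum>i=1..I. lam i *\<^sub>R \<xi>s i) \<and>
        (\<Sum>i\<in>{i\<in>{1..I}. \<xi>s i \<notin> dist_nbhd \<epsilon> E}. lam i) < \<epsilon>"
  shows "f \<xi> \<le> 0"
proof (rule field_le_epsilon)
  fix e :: real
  assume "e > 0"
  define \<delta> where "\<delta> = e / 2"
  have \<delta>: "\<delta> > 0" using \<open>e > 0\<close> by (simp add: \<delta>_def)
  have "compact (f ` closure U)"
    using \<open>bounded U\<close> by (intro compact_continuous_image rank_one_convex_continuous_on f) simp
  then obtain M where M: "M > 0" "\<And>x. x \<in> U \<Longrightarrow> f x \<le> M"
    using compact_imp_bounded [THEN bounded_pos [THEN iffD1]] closure_subset
    by (metis (no_types, lifting) abs_le_D1 image_eqI real_norm_def subset_iff)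
  have "open {x. f x < \<delta>}"
    by (intro open_Collect_less rank_one_convex_continuous_on f continuous_on_const)
  moreover have "E \<subseteq> {x. f x < \<delta>}" using E \<delta> by force
  ultimately obtain r where r: "r > 0" "(\<Union>x\<in>E. ball x r) \<subseteq> {x. f x < \<delta>}"
    using compact_subset_open_imp_ball_epsilon_subset \<open>compact E\<close> by metis
  \<comment> \<open>The bound \<open>r\<close> ensures \<open>f x < \<delta>\<close> on the
    neighbourhood of \<open>E\<close>; the bound \<open>\<delta> / M\<close> keeps the contribution
    of the remaining members below \<open>\<delta>\<close>.\<close>
  define \<epsilon> where "\<epsilon> = min r (\<delta> / M)"
  have \<epsilon>: "\<epsilon> > 0" "\<epsilon> \<le> r" "M * \<epsilon> \<le> \<delta>"
    using r \<delta> M by (auto simp: \<epsilon>_def min_def field_simps)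
  have near: "f x < \<delta>" if "x \<in> dist_nbhd \<epsilon> E" for x
  proof -
    have "E \<noteq> {}" "infdist x E < \<epsilon>" using that by (auto simp: dist_nbhd_def)
    then obtain y where "y \<in> E" "dist x y < \<epsilon>"
      by (metis infdist_attains_inf compact_imp_closed \<open>compact E\<close>)
    then have "x \<in> (\<Union>x\<in>E. ball x r)"
      using \<epsilon> by (auto simp: dist_commute intro!: bexI [of _ y])
    with r show ?thesis by blast
  qed
  obtain I lam \<xi>s where lam: "\<And>i. i \<in> {1..I} \<Longrightarrow> lam i > 0" "(\<Sum>i=1..I. lam i) = 1"
    and H: "satisfies_H I U lam \<xi>s" and \<xi>: "\<xi> = (\<Sum>i=1..I. lam i *\<^sub>R \<xi>s i)"
    and bad: "(\<Sum>i\<in>{i\<in>{1..I}. \<xi>s i \<notin> dist_nbhd \<epsilon> E}. lam i) < \<epsilon>"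
    using approx [OF \<epsilon>(1)] by blast
  have "f \<xi> \<le> (\<Sum>i=1..I. lam i * f (\<xi>s i))"
    unfolding \<xi> using f H lam by (rule satisfies_H_Jensen)
  also have "\<dots> \<le> (\<Sum>i=1..I. M * (if \<xi>s i \<notin> dist_nbhd \<epsilon> E then lam i else 0) + \<delta> * lam i)"
  proof (rule sum_mono)
    fix i assume i: "i \<in> {1..I}"
    have "lam i * f (\<xi>s i) \<le> lam i * (if \<xi>s i \<notin> dist_nbhd \<epsilon> E then M else \<delta>)"
      using lam(1) [OF i] near [of "\<xi>s i"] M(2) satisfies_H_mem [OF H i]
      by (intro mult_left_mono) auto
    also have "\<dots> \<le> M * (if \<xi>s i \<notin> dist_nbhd \<epsilon> E then lam i else 0) + \<delta> * lam i"
      using lam(1) [OF i] \<delta> by (simp add: mult.commute)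
    finally show "lam i * f (\<xi>s i)
        \<le> M * (if \<xi>s i \<notin> dist_nbhd \<epsilon> E then lam i else 0) + \<delta> * lam i" .
  qed
  also have "\<dots> = M * (\<Sum>i\<in>{i\<in>{1..I}. \<xi>s i \<notin> dist_nbhd \<epsilon> E}. lam i) + \<delta> * (\<Sum>i=1..I. lam i)"
    by (simp only: sum.distrib sum_distrib_left [symmetric] sum.inter_filter finite_atLeastAtMost)
  also have "\<dots> \<le> M * \<epsilon> + \<delta>"
    using bad M lam(2) by simp
  also have "\<dots> \<le> 0 + e"
    using \<epsilon> by (simp add: \<delta>_def)
  finally show "f \<xi> \<le> 0 + e" .
qed

section \<open>Laminates\<close>

text \<open>Families are multisets of pairs of a weight and a point, so that splittings involve no
  indices or permutations. The vector-valued \<open>g\<close> covers total mass, barycenters and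
  averages alike.\<close>

definition weighted_sum :: "('a \<Rightarrow> 'b::real_vector) \<Rightarrow> (real \<times> 'a) multiset \<Rightarrow> 'b" where
  "weighted_sum g M = (\<Sum>z\<in>#M. fst z *\<^sub>R g (snd z))"

definition scale :: "real \<Rightarrow> (real \<times> 'a) multiset \<Rightarrow> (real \<times> 'a) multiset" where
  "scale c M = image_mset (\<lambda>z. (c * fst z, snd z)) M"

lemma weighted_sum_union [simp]: "weighted_sum g (M + N) = weighted_sum g M + weighted_sum g N"
  by (simp add: weighted_sum_def)

lemma weighted_sum_single [simp]: "weighted_sum g {#(w, x)#} = w *\<^sub>R g x"
  by (simp add: weighted_sum_def)

lemma weighted_sum_scale [simp]: "weighted_sum g (scale c M) = c *\<^sub>R weighted_sum g M"
  by (induction M) (simp_all add: weighted_sum_def scale_def scaleR_add_right)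

lemma scale_union [simp]: "scale c (M + N) = scale c M + scale c N"
  by (simp add: scale_def)

lemma scale_single [simp]: "scale c {#(w, x)#} = {#(c * w, x)#}"
  by (simp add: scale_def)

lemma scale_scale [simp]: "scale c (scale d M) = scale (c * d) M"
  by (simp add: scale_def multiset.map_comp comp_def mult.assoc)

lemma scale_1 [simp]: "scale 1 M = M"
  by (simp add: scale_def)

text \<open>Unlike in \<open>satisfies_H\<close>, the barycenter of the whole family has to lie in \<open>U\<close> too; this makes it
  possible to replace a member of a family by a laminate with that barycenter.\<close>

inductive laminate :: "(real ^ 'n ^ 'm) set \<Rightarrow> real ^ 'n ^ 'm \<Rightarrow> (real \<times> (real ^ 'n ^ 'm)) multiset \<Rightarrow> bool"
  for U where
  single: "\<xi> \<in> U \<Longrightarrow> laminate U \<xi> {#(1, \<xi>)#}"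
| split: "laminate U \<xi> M \<Longrightarrow> laminate U \<eta> N \<Longrightarrow> rank (\<xi> - \<eta>) = 1 \<Longrightarrow> 0 < t \<Longrightarrow> t < 1 \<Longrightarrow>
    t *\<^sub>R \<xi> + (1 - t) *\<^sub>R \<eta> \<in> U \<Longrightarrow>
    laminate U (t *\<^sub>R \<xi> + (1 - t) *\<^sub>R \<eta>) (scale t M + scale (1 - t) N)"

lemma laminate_mem: "laminate U \<xi> M \<Longrightarrow> \<xi> \<in> U"
  by (induction rule: laminate.induct) auto

lemma laminate_weight_pos: "laminate U \<xi> M \<Longrightarrow> z \<in># M \<Longrightarrow> 0 < fst z"
  by (induction arbitrary: z rule: laminate.induct) (auto simp: scale_def)

lemma laminate_weighted_sum_const: "laminate U \<xi> M \<Longrightarrow> weighted_sum (\<lambda>_. 1::real) M = 1"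
  by (induction rule: laminate.induct) auto

lemma laminate_barycenter: "laminate U \<xi> M \<Longrightarrow> weighted_sum (\<lambda>x. x) M = \<xi>"
  by (induction rule: laminate.induct) auto

section \<open>From laminates to families satisfying the recursive property\<close>

text \<open>Quantifying over all enumerations makes the hypothesis available for the particular
  enumeration that a recursive clause of \<open>satisfies_H\<close> produces. It is not vacuous,
  since every finite multiset has an enumeration.\<close>

definition enum_satisfies_H :: "(real ^ 'n ^ 'm) set \<Rightarrow> (real \<times> (real ^ 'n ^ 'm)) multiset \<Rightarrow> bool" where
  "enum_satisfies_H U M \<longleftrightarrow>
    (\<forall>I lam \<xi>. image_mset (\<lambda>i. (lam i, \<xi> i)) (mset_set {1..I}) = M \<longrightarrow> satisfies_H I U lam \<xi>)"

lemma ex_permutes_first_two: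
  fixes a b n :: nat
  assumes "a \<in> {1..n}" "b \<in> {1..n}" "a \<noteq> b" "2 \<le> n"
  obtains p where "p permutes {1..n}" "p 1 = a" "p 2 = b"
proof
  let ?q = "Transposition.transpose 1 a"
  \<comment> \<open>\<open>?q\<close> is an involution, so \<open>2\<close> goes to
    \<open>?q b\<close> and then to \<open>b\<close>. As \<open>b\<close> differs from
    \<open>a\<close>, \<open>?q b\<close> is not \<open>1\<close>; hence the inner transposition
    fixes \<open>1\<close>, which \<open>?q\<close> sends to \<open>a\<close>.\<close>
  let ?p = "?q \<circ> Transposition.transpose 2 (?q b)"
  have "?q b \<in> {1..n}" using assms by (auto simp: Transposition.transpose_def)
  then show "?p permutes {1..n}"
    using assms by (intro permutes_compose permutes_swap_id) auto
  show "?p 1 = a" "?p 2 = b"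
    using assms by (auto simp: Transposition.transpose_def)
qed

text \<open>This is the recursive clause read backwards: in any enumeration, a permutation brings
  the two atoms to the front, and merging them gives an enumeration of the multiset in the
  hypothesis.\<close>

lemma enum_satisfies_H_split:
  assumes U: "\<xi>1 \<in> U" "\<xi>2 \<in> U" and rk: "rank (\<xi>1 - \<xi>2) = 1"
    and H: "enum_satisfies_H U
      (add_mset (l1 + l2, (1 / (l1 + l2)) *\<^sub>R (l1 *\<^sub>R \<xi>1 + l2 *\<^sub>R \<xi>2)) R)"
  shows "enum_satisfies_H U (add_mset (l1, \<xi>1) (add_mset (l2, \<xi>2) R))"
  unfolding enum_satisfies_H_def
proof (intro allI impI)
  fix I :: nat and lam :: "nat \<Rightarrow> real" and \<xi> :: "nat \<Rightarrow> real ^ 'a ^ 'b"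
  let ?F = "\<lambda>i. (lam i, \<xi> i)"
  assume eq: "image_mset ?F (mset_set {1..I}) = add_mset (l1, \<xi>1) (add_mset (l2, \<xi>2) R)"
  then have "size (image_mset ?F (mset_set {1..I})) = size R + 2" by simp
  then have I: "I = size R + 2" by simp
  show "satisfies_H I U lam \<xi>"
  proof (cases "size R")
    \<comment> \<open>The base clause for two members has no permutation, so both orders of the
      atoms have to be checked.\<close>
    case 0
    then have I2: "I = Suc (Suc 0)" and R: "R = {#}" using I by auto
    have "{1..I} = {1, 2}" using I2 by auto
    then have "{#?F 1, ?F 2#} = {#(l1, \<xi>1), (l2, \<xi>2)#}"
      using eq R by simp
    then have "(\<xi> 1 = \<xi>1 \<and> \<xi> 2 = \<xi>2) \<or> (\<xi> 1 = \<xi>2 \<and> \<xi> 2 = \<xi>1)"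
      by (auto simp: add_eq_conv_ex)
    then show ?thesis
      unfolding I2 using U rk rank_minus_commute [of \<xi>1 \<xi>2] by auto
  next
    case (Suc k)
    then have I3: "I = Suc (Suc (Suc k))" using I by simp
    \<comment> \<open>The indices of the two atoms are chosen one after the other, the second
      outside \<open>{a}\<close>, so that they are distinct and the remaining indices enumerate
      exactly \<open>R\<close>.\<close>
    have "(l1, \<xi>1) \<in># image_mset ?F (mset_set {1..I})" unfolding eq by simp
    then obtain a where a: "a \<in> {1..I}" "?F a = (l1, \<xi>1)" by auto
    have "mset_set {1..I} = add_mset a (mset_set ({1..I} - {a}))"
      using a(1) by (simp add: mset_set.remove)
    then have eq1: "image_mset ?F (mset_set ({1..I} - {a})) = add_mset (l2, \<xi>2) R"
      using eq a(2) by simp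
    then have "(l2, \<xi>2) \<in># image_mset ?F (mset_set ({1..I} - {a}))" by simp
    then obtain b where "b \<in># mset_set ({1..I} - {a})" "?F b = (l2, \<xi>2)"
      by (metis (mono_tags, lifting) imageE in_image_mset)
    then have b: "b \<in> {1..I} - {a}" "?F b = (l2, \<xi>2)" by simp_all
    have "mset_set ({1..I} - {a}) = add_mset b (mset_set ({1..I} - {a} - {b}))"
      using b(1) by (simp add: mset_set.remove)
    then have eq2: "image_mset ?F (mset_set ({1..I} - {a} - {b})) = R"
      using eq1 b(2) by simp
    obtain p where p: "p permutes {1..I}" "p 1 = a" "p 2 = b"
      by (rule ex_permutes_first_two [of a I b]) (use a b I in auto)
    have inj: "inj_on (\<lambda>i. p (i + 1)) S" for S
      using permutes_inj [OF p(1)] by (auto simp: inj_on_def inj_def)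
    \<comment> \<open>The remaining indices are the images under \<open>p\<close> of
      \<open>3, ..., I\<close>, that is, of \<open>i + 1\<close> for \<open>i\<close> in
      \<open>{2..Suc (Suc k)}\<close>.\<close>
    have "{1..I} - {a} - {b} = p ` ({1..I} - {1} - {2})"
      by (simp only: image_set_diff [OF permutes_inj [OF p(1)]] image_insert image_empty
          permutes_image [OF p(1)] p(2,3))
    also have "{1..I} - {1} - {2} = (\<lambda>i. i + 1) ` {2..Suc (Suc k)}"
      unfolding image_add_atLeastAtMost' using I3 by auto
    finally have "{1..I} - {a} - {b} = (\<lambda>i. p (i + 1)) ` {2..Suc (Suc k)}"
      by (simp only: image_image)
    then have "mset_set ({1..I} - {a} - {b}) = image_mset (\<lambda>i. p (i + 1)) (mset_set {2..Suc (Suc k)})"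
      by (simp only: image_mset_mset_set [OF inj])
    then have R: "image_mset (\<lambda>i. ?F (p (i + 1))) (mset_set {2..Suc (Suc k)}) = R"
      using eq2 by (simp add: multiset.map_comp comp_def)
    let ?\<mu> = "\<lambda>i. if i = 1 then lam (p 1) + lam (p 2) else lam (p (i + 1))"
    let ?\<eta> = "\<lambda>i. if i = 1
             then (1 / (lam (p 1) + lam (p 2))) *\<^sub>R (lam (p 1) *\<^sub>R \<xi> (p 1) + lam (p 2) *\<^sub>R \<xi> (p 2))
             else \<xi> (p (i + 1))"
    have "{1..Suc (Suc k)} = insert 1 {2..Suc (Suc k)}" by auto
    then have "image_mset (\<lambda>i. (?\<mu> i, ?\<eta> i)) (mset_set {1..Suc (Suc k)})
        = add_mset (?\<mu> 1, ?\<eta> 1) (image_mset (\<lambda>i. (?\<mu> i, ?\<eta> i)) (mset_set {2..Suc (Suc k)}))"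
      by simp
    also have "image_mset (\<lambda>i. (?\<mu> i, ?\<eta> i)) (mset_set {2..Suc (Suc k)})
        = image_mset (\<lambda>i. ?F (p (i + 1))) (mset_set {2..Suc (Suc k)})"
      by (rule image_mset_cong) auto
    also note R
    finally have "satisfies_H (Suc (Suc k)) U ?\<mu> ?\<eta>"
      using H a(2) b(2) p(2,3) unfolding enum_satisfies_H_def by simp
    then show ?thesis
      unfolding I3 satisfies_H.simps using p(1) a(2) b(2) U rk
      by (intro exI [of _ p]) (simp add: p(2) [unfolded One_nat_def] p(3) I3)
  qed
qed

text \<open>One atom is refined while the others, collected in \<open>R\<close>, are carried along.
  For a split, the atom is first replaced by atoms at \<open>\<xi>\<close> and
  \<open>\<eta>\<close>, and these are then refined in turn; this is why \<open>w\<close> and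
  \<open>R\<close> vary in the induction.\<close>

lemma laminate_enum_satisfies_H_add:
  "laminate U \<xi> M \<Longrightarrow> 0 < w \<Longrightarrow> enum_satisfies_H U (add_mset (w, \<xi>) R) \<Longrightarrow>
    enum_satisfies_H U (scale w M + R)"
proof (induction arbitrary: w R rule: laminate.induct)
  case (split \<xi> M \<eta> N t)
  have "w * t + w * (1 - t) = w"
    by (simp add: algebra_simps)
  moreover have "(1 / w) *\<^sub>R ((w * t) *\<^sub>R \<xi> + (w * (1 - t)) *\<^sub>R \<eta>) = t *\<^sub>R \<xi> + (1 - t) *\<^sub>R \<eta>"
    using split.prems by (simp add: scaleR_add_right)
  ultimately have "enum_satisfies_H U (add_mset (w * t, \<xi>) (add_mset (w * (1 - t), \<eta>) R))"
    using split by (intro enum_satisfies_H_split) (auto intro: laminate_mem)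
  then have "enum_satisfies_H U (add_mset (w * (1 - t), \<eta>) (scale (w * t) M + R))"
    using split.IH(1) [of "w * t" "add_mset (w * (1 - t), \<eta>) R"] split by simp
  then have "enum_satisfies_H U (scale (w * (1 - t)) N + (scale (w * t) M + R))"
    using split by simp
  then show ?case
    by (simp add: ac_simps)
qed simp

lemma laminate_enum_satisfies_H:
  assumes "laminate U \<xi> M"
  shows "enum_satisfies_H U M"
proof -
  have "enum_satisfies_H U {#(1, \<xi>)#}"
    unfolding enum_satisfies_H_def
  proof (intro allI impI)
    fix I :: nat and lam :: "nat \<Rightarrow> real" and \<xi>s :: "nat \<Rightarrow> real ^ 'a ^ 'b"
    assume eq: "image_mset (\<lambda>i. (lam i, \<xi>s i)) (mset_set {1..I}) = {#(1, \<xi>)#}"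
    then have "size (image_mset (\<lambda>i. (lam i, \<xi>s i)) (mset_set {1..I})) = 1" by simp
    then have "I = Suc 0" by simp
    with eq show "satisfies_H I U lam \<xi>s"
      using laminate_mem [OF assms] by simp
  qed
  from laminate_enum_satisfies_H_add [OF assms _ this] show ?thesis
    by simp
qed

lemma ex_enumeration_mset:
  fixes M :: "('a \<times> 'b) multiset"
  obtains lam \<xi> where "image_mset (\<lambda>i. (lam i, \<xi> i)) (mset_set {1..size M}) = M"
proof -
  obtain xs where xs: "mset xs = M" using ex_mset by blast
  have "map (\<lambda>i. xs ! (i - 1)) [1..<Suc (length xs)] = xs"
    by (rule nth_equalityI) (auto simp del: upt_Suc)
  then have "image_mset (\<lambda>i. xs ! (i - 1)) (mset [1..<Suc (length xs)]) = M"
    using xs by (metis mset_map)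
  also have "mset [1..<Suc (length xs)] = mset_set {1..size M}"
    by (metis atLeastLessThanSuc_atLeastAtMost mset_upt size_mset xs)
  finally show thesis
    by (intro that [of "\<lambda>i. fst (xs ! (i - 1))" "\<lambda>i. snd (xs ! (i - 1))"]) simp
qed

lemma laminate_imp_satisfies_H:
  assumes "laminate U \<xi> M"
  obtains I lam \<xi>s where "I \<ge> 1" "satisfies_H I U lam \<xi>s" "\<And>i. i \<in> {1..I} \<Longrightarrow> 0 < lam i"
    "(\<Sum>i=1..I. lam i) = 1" "\<xi> = (\<Sum>i=1..I. lam i *\<^sub>R \<xi>s i)"
    "\<And>g. (\<Sum>i=1..I. lam i * g (\<xi>s i)) = weighted_sum g M"
proof -
  obtain lam \<xi>s where eq: "image_mset (\<lambda>i. (lam i, \<xi>s i)) (mset_set {1..size M}) = M"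
    by (rule ex_enumeration_mset)
  have mean: "weighted_sum g M = (\<Sum>i=1..size M. lam i *\<^sub>R g (\<xi>s i))" for g :: "real ^ 'a ^ 'b \<Rightarrow> 'c::real_vector"
    by (subst eq [symmetric]) (simp add: weighted_sum_def multiset.map_comp comp_def sum_unfold_sum_mset)
  have H: "satisfies_H (size M) U lam \<xi>s"
    using laminate_enum_satisfies_H [OF assms] eq by (simp add: enum_satisfies_H_def)
  show thesis
  proof
    show "size M \<ge> 1" using H by (cases "size M") auto
    show "0 < lam i" if "i \<in> {1..size M}" for i
    proof -
      have "(lam i, \<xi>s i) \<in># M"
        by (subst eq [symmetric]) (use that in auto)
      from laminate_weight_pos [OF assms this] show ?thesis by simp
    qed
    show "(\<Sum>i=1..size M. lam i) = 1"
      using laminate_weighted_sum_const [OF assms] mean [of "\<lambda>_. 1::real"] by simp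
    show "\<xi> = (\<Sum>i=1..size M. lam i *\<^sub>R \<xi>s i)"
      using laminate_barycenter [OF assms] mean [of "\<lambda>x. x"] by simp
    show "(\<Sum>i=1..size M. lam i * g (\<xi>s i)) = weighted_sum g M" for g
      using mean [of g] by simp
  qed (rule H)
qed

section \<open>The laminate envelope\<close>

text \<open>Meaningful for \<open>\<xi>\<close> in \<open>U\<close> only: no laminate has its
  barycenter outside \<open>U\<close>, and there the infimum is over the empty set.\<close>

definition laminate_envelope ::
    "(real ^ 'n ^ 'm) set \<Rightarrow> (real ^ 'n ^ 'm \<Rightarrow> real) \<Rightarrow> real ^ 'n ^ 'm \<Rightarrow> real" where
  "laminate_envelope U g \<xi> = (INF M\<in>{M. laminate U \<xi> M}. weighted_sum g M)"

context
  fixes U :: "(real ^ 'n ^ 'm) set" and g :: "real ^ 'n ^ 'm \<Rightarrow> real"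
  assumes g_nonneg: "\<And>x. 0 \<le> g x"
begin

lemma laminate_weighted_sum_nonneg:
  assumes "laminate U \<xi> M"
  shows "0 \<le> weighted_sum g M"
proof -
  have "(\<Sum>z\<in>#M. 0) \<le> (\<Sum>z\<in>#M. fst z * g (snd z))"
    using laminate_weight_pos [OF assms] g_nonneg
    by (intro sum_mset_mono mult_nonneg_nonneg) (simp_all add: less_imp_le)
  then show ?thesis by (simp add: weighted_sum_def)
qed

lemma laminate_envelope_le_weighted_sum:
  assumes "laminate U \<xi> M"
  shows "laminate_envelope U g \<xi> \<le> weighted_sum g M"
  unfolding laminate_envelope_def
proof (rule cINF_lower)
  show "bdd_below (weighted_sum g ` {M. laminate U \<xi> M})"
    by (rule bdd_belowI2 [where m = 0]) (simp add: laminate_weighted_sum_nonneg)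
qed (use assms in simp)

lemma laminate_envelope_le: "\<xi> \<in> U \<Longrightarrow> laminate_envelope U g \<xi> \<le> g \<xi>"
  using laminate_envelope_le_weighted_sum [OF laminate.single, of \<xi>] by simp

lemma ex_laminate_weighted_sum_less:
  assumes "\<xi> \<in> U" "laminate_envelope U g \<xi> < c"
  obtains M where "laminate U \<xi> M" "weighted_sum g M < c"
proof -
  have "weighted_sum g ` {M. laminate U \<xi> M} \<noteq> {}"
    using assms(1) laminate.single by fastforce
  then obtain y where "y \<in> weighted_sum g ` {M. laminate U \<xi> M}" "y < c"
    using assms(2) cInf_lessD unfolding laminate_envelope_def by metis
  then show thesis using that by blast
qed

text \<open>Nearly optimal laminates for \<open>\<xi>\<close> and \<open>\<eta>\<close> are combined
  by one further splitting into a competitor for the convex combination; their errors average to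
  \<open>e\<close>.\<close>

lemma laminate_envelope_convex_rank_one:
  assumes U: "\<xi> \<in> U" "\<eta> \<in> U" "t *\<^sub>R \<xi> + (1 - t) *\<^sub>R \<eta> \<in> U"
    and rk: "rank (\<xi> - \<eta>) = 1" and t: "0 < t" "t < 1"
  shows "laminate_envelope U g (t *\<^sub>R \<xi> + (1 - t) *\<^sub>R \<eta>)
    \<le> t * laminate_envelope U g \<xi> + (1 - t) * laminate_envelope U g \<eta>"
proof (rule field_le_epsilon)
  fix e :: real
  assume e: "e > 0"
  obtain M where M: "laminate U \<xi> M" "weighted_sum g M < laminate_envelope U g \<xi> + e"
    using ex_laminate_weighted_sum_less [OF U(1)] e by (metis less_add_same_cancel1)
  obtain N where N: "laminate U \<eta> N" "weighted_sum g N < laminate_envelope U g \<eta> + e"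
    using ex_laminate_weighted_sum_less [OF U(2)] e by (metis less_add_same_cancel1)
  have "laminate_envelope U g (t *\<^sub>R \<xi> + (1 - t) *\<^sub>R \<eta>) \<le> weighted_sum g (scale t M + scale (1 - t) N)"
    using M N rk t U by (intro laminate_envelope_le_weighted_sum laminate.split)
  also have "\<dots> = t * weighted_sum g M + (1 - t) * weighted_sum g N" by simp
  also have "\<dots> \<le> t * (laminate_envelope U g \<xi> + e) + (1 - t) * (laminate_envelope U g \<eta> + e)"
    using M N t by (intro add_mono mult_left_mono) auto
  also have "\<dots> = t * laminate_envelope U g \<xi> + (1 - t) * laminate_envelope U g \<eta> + e"
    by (simp add: algebra_simps)
  finally show "laminate_envelope U g (t *\<^sub>R \<xi> + (1 - t) *\<^sub>R \<eta>)
    \<le> t * laminate_envelope U g \<xi> + (1 - t) * laminate_envelope U g \<eta> + e" .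
qed

text \<open>Splittings must stay inside \<open>U\<close>, so convexity is claimed on parameter sets
  for which the line remains in \<open>U\<close>.\<close>

lemma laminate_envelope_convex_on_line:
  assumes rk: "rank u = 1" and S: "convex S" "\<And>t. t \<in> S \<Longrightarrow> x + t *\<^sub>R u \<in> U"
  shows "convex_on S (\<lambda>t::real. laminate_envelope U g (x + t *\<^sub>R u))"
proof (rule convex_on_linorderI)
  fix t r s :: real
  assume t: "0 < t" "t < 1" and rs: "r \<in> S" "s \<in> S" "r < s"
  have "(x + s *\<^sub>R u) - (x + r *\<^sub>R u) = (s - r) *\<^sub>R u"
    by (simp add: algebra_simps)
  then have "rank ((x + s *\<^sub>R u) - (x + r *\<^sub>R u)) = 1"
    using rs rk by (simp add: rank_scaleR)
  moreover have eq: "t *\<^sub>R (x + s *\<^sub>R u) + (1 - t) *\<^sub>R (x + r *\<^sub>R u)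
        = x + ((1 - t) *\<^sub>R r + t *\<^sub>R s) *\<^sub>R u"
    by (simp add: algebra_simps)
  moreover have "(1 - t) *\<^sub>R r + t *\<^sub>R s \<in> S"
    using S(1) rs t by (intro convexD) auto
  ultimately show "laminate_envelope U g (x + ((1 - t) *\<^sub>R r + t *\<^sub>R s) *\<^sub>R u)
      \<le> (1 - t) * laminate_envelope U g (x + r *\<^sub>R u) + t * laminate_envelope U g (x + s *\<^sub>R u)"
    using laminate_envelope_convex_rank_one [of "x + s *\<^sub>R u" "x + r *\<^sub>R u" t] S(2) rs t by simp
qed (rule S(1))

end

section \<open>Extending the envelope by a function that is large on the frontier\<close>

lemma subset_Rco_f: "E \<subseteq> Rco_f E"
  by (auto simp: Rco_f_def)

lemma rank_one_convex_dominate_finite: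
  assumes "finite A" "\<And>f. f \<in> A \<Longrightarrow> rank_one_convex f \<and> (\<forall>\<eta>\<in>E. f \<eta> \<le> 0)"
  obtains f0 where "rank_one_convex f0" "\<forall>\<eta>\<in>E. f0 \<eta> \<le> 0" "\<And>f x. f \<in> A \<Longrightarrow> f x \<le> f0 x"
proof -
  have "\<exists>f0. rank_one_convex f0 \<and> (\<forall>\<eta>\<in>E. f0 \<eta> \<le> 0) \<and> (\<forall>f\<in>A. \<forall>x. f x \<le> f0 x)"
    using assms
  proof (induction rule: finite_induct)
    case empty
    then show ?case
      by (intro exI [of _ "\<lambda>_. 0"]) (simp add: rank_one_convex_const)
  next
    case (insert h A)
    then obtain f0 where "rank_one_convex f0" "\<forall>\<eta>\<in>E. f0 \<eta> \<le> 0" "\<forall>f\<in>A. \<forall>x. f x \<le> f0 x"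
      by auto
    with insert.prems show ?case
      by (intro exI [of _ "\<lambda>x. max (h x) (f0 x)"])
        (auto simp: rank_one_convex_max le_max_iff_disj)
  qed
  then show thesis using that by blast
qed

text \<open>Each point of \<open>K\<close> has an admissible function positive there, which a
  nonnegative factor lifts above \<open>D\<close>. By continuity the sets where such functions
  exceed \<open>D\<close> form an open cover of \<open>K\<close>; the maximum over a finite subcover
  works everywhere on \<open>K\<close>.\<close>

lemma rank_one_convex_large_on_compact:
  assumes "compact K" "K \<inter> Rco_f E = {}"
  obtains f0 where "rank_one_convex f0" "\<forall>\<eta>\<in>E. f0 \<eta> \<le> 0" "\<And>x. x \<in> K \<Longrightarrow> D < f0 x"
proof -
  define \<F> where "\<F> = {f. rank_one_convex f \<and> (\<forall>\<eta>\<in>E. f \<eta> \<le> 0)}"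
  have "open {x. D < f x}" if "f \<in> \<F>" for f
    using that unfolding \<F>_def
    by (intro open_Collect_less rank_one_convex_continuous_on continuous_on_const) auto
  moreover have "K \<subseteq> (\<Union>f\<in>\<F>. {x. D < f x})"
  proof
    fix x assume "x \<in> K"
    then obtain f where f: "rank_one_convex f" "\<forall>\<eta>\<in>E. f \<eta> \<le> 0" "0 < f x"
      using assms(2) by (force simp: Rco_f_def)
    \<comment> \<open>Chosen so that the scaled function takes the value
      \<open>\<bar>D\<bar> + 1\<close> at \<open>x\<close>, which exceeds \<open>D\<close>.\<close>
    define c where "c = (\<bar>D\<bar> + 1) / f x"
    have "0 \<le> c" "c * f x = \<bar>D\<bar> + 1" using f by (auto simp: c_def)
    moreover from this have "(\<lambda>x. c * f x) \<in> \<F>"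
      using f by (auto simp: \<F>_def rank_one_convex_cmul mult_nonneg_nonpos)
    ultimately show "x \<in> (\<Union>f\<in>\<F>. {x. D < f x})"
      by (intro UN_I [of "\<lambda>x. c * f x"]) auto
  qed
  ultimately obtain A where A: "A \<subseteq> \<F>" "finite A" "K \<subseteq> (\<Union>f\<in>A. {x. D < f x})"
    using compactE_image [OF \<open>compact K\<close>] by metis
  obtain f0 where f0: "rank_one_convex f0" "\<forall>\<eta>\<in>E. f0 \<eta> \<le> 0"
    and ge: "\<And>f x. f \<in> A \<Longrightarrow> f x \<le> f0 x"
    using rank_one_convex_dominate_finite [OF A(2), of E] A(1) by (auto simp: \<F>_def)
  have "D < f0 x" if x: "x \<in> K" for x
  proof -
    obtain f where "f \<in> A" "D < f x" using A(3) x by blast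
    with ge [of f x] show ?thesis by simp
  qed
  with f0 show thesis
    by (rule that)
qed

lemma convex_on_cong:
  assumes f: "convex_on S f" and eq: "\<And>x. x \<in> S \<Longrightarrow> g x = f x"
  shows "convex_on S g"
proof (rule convex_onI)
  fix t :: real and x y
  assume t: "0 < t" "t < 1" and S: "x \<in> S" "y \<in> S"
  have "(1 - t) *\<^sub>R x + t *\<^sub>R y \<in> S"
    using convex_on_imp_convex [OF f] t S by (intro convexD) auto
  with convex_onD [OF f, of t x y] t S
  show "g ((1 - t) *\<^sub>R x + t *\<^sub>R y) \<le> (1 - t) * g x + t * g y"
    by (simp add: eq)
qed (use f convex_on_imp_convex in blast)

lemma open_line_interval:
  fixes x u :: "'a::real_normed_vector"
  assumes "open V" "x + t *\<^sub>R u \<in> V"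
  obtains \<delta> :: real where "\<delta> > 0" "\<And>s. s \<in> {t - \<delta><..<t + \<delta>} \<Longrightarrow> x + s *\<^sub>R u \<in> V"
proof -
  have "open ((\<lambda>s. x + s *\<^sub>R u) -` V)"
    by (intro open_vimage assms continuous_intros)
  then obtain \<delta> where "\<delta> > 0" "ball t \<delta> \<subseteq> (\<lambda>s. x + s *\<^sub>R u) -` V"
    using assms(2) open_contains_ball by blast
  moreover have "ball t \<delta> = {t - \<delta><..<t + \<delta>}"
    by (auto simp: dist_real_def)
  ultimately show thesis
    by (intro that [of \<delta>]) auto
qed

text \<open>The glued function \<open>F\<close> is rank one convex on the whole space and
  nonpositive on \<open>E\<close>, so it is nonpositive at \<open>\<xi>\<close>, where it bounds the
  envelope from above.\<close>

lemma laminate_envelope_le_0: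
  fixes E U :: "(real ^ 'n ^ 'm) set"
  assumes U: "open U" "bounded U" "Rco_f E \<subseteq> U" and \<xi>: "\<xi> \<in> Rco_f E"
  shows "laminate_envelope U (\<lambda>x. infdist x E) \<xi> \<le> 0"
proof -
  let ?h = "laminate_envelope U (\<lambda>x. infdist x E)"
  have "compact ((\<lambda>x. infdist x E) ` closure U)"
    using \<open>bounded U\<close> by (intro compact_continuous_image continuous_intros) simp
  then obtain D where "\<And>x. x \<in> U \<Longrightarrow> infdist x E \<le> D"
    using compact_imp_bounded [THEN bounded_pos [THEN iffD1]] closure_subset
    by (metis (no_types, lifting) abs_le_D1 image_eqI real_norm_def subset_iff)
  then have D: "?h x \<le> D" if "x \<in> U" for x
    using laminate_envelope_le [where g = "\<lambda>x. infdist x E", OF infdist_nonneg that] that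
    by fastforce
  have "compact (frontier U)"
    using \<open>bounded U\<close> by (rule compact_frontier_bounded)
  moreover have "frontier U \<inter> Rco_f E = {}"
    using U by (auto simp: frontier_def interior_open)
  ultimately obtain f0 where f0: "rank_one_convex f0" "\<forall>\<eta>\<in>E. f0 \<eta> \<le> 0"
    "\<And>x. x \<in> frontier U \<Longrightarrow> D < f0 x"
    by (rule rank_one_convex_large_on_compact) blast
  \<comment> \<open>An open set containing the complement of \<open>U\<close>. On it
    \<open>F\<close> is just \<open>f0\<close>: inside \<open>U\<close> the envelope is at most
    \<open>D\<close>, so \<open>f0\<close> wins wherever it exceeds \<open>D\<close>.\<close>
  define W where "W = - closure U \<union> {x. D < f0 x}"
  define F where "F x = (if x \<in> U then max (?h x) (f0 x) else f0 x)" for x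
  have "open W"
    unfolding W_def
    by (intro open_Un open_Collect_less rank_one_convex_continuous_on f0 continuous_on_const) auto
  have cover: "x \<in> W" if "x \<notin> U" for x
    using that f0(3) [of x] U(1) by (auto simp: W_def frontier_def interior_open)
  have FW: "F x = f0 x" if "x \<in> W" for x
    using that D [of x] closure_subset [of U] by (auto simp: F_def W_def max_def)
  have f0_line: "convex_on S (\<lambda>t::real. f0 (x + t *\<^sub>R u))" if "rank u = 1" "convex S" for S x u
    using f0(1) that convex_on_subset unfolding rank_one_convex_iff_convex_on_lines by blast
  \<comment> \<open>The open sets \<open>U\<close> and \<open>W\<close> cover the space. Near a
    point of \<open>U\<close> a line sees a maximum of two convex functions, and near any other
    point it sees \<open>f0\<close> alone.\<close>
  have "rank_one_convex F"
    unfolding rank_one_convex_iff_convex_on_lines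
  proof (intro allI impI locally_convex_imp_convex)
    fix x u :: "real ^ 'n ^ 'm" and t :: real
    assume u: "rank u = 1"
    show "\<exists>\<delta>>0. convex_on {t - \<delta><..<t + \<delta>} (\<lambda>t. F (x + t *\<^sub>R u))"
    proof (cases "x + t *\<^sub>R u \<in> U")
      case True
      then obtain \<delta> where \<delta>: "\<delta> > 0" "\<And>s. s \<in> {t - \<delta><..<t + \<delta>} \<Longrightarrow> x + s *\<^sub>R u \<in> U"
        by (rule open_line_interval [OF U(1)]) blast
      have "convex_on {t - \<delta><..<t + \<delta>} (\<lambda>t. max (?h (x + t *\<^sub>R u)) (f0 (x + t *\<^sub>R u)))"
        using \<delta>(2) u
        by (intro convex_on_max f0_line laminate_envelope_convex_on_line) (auto simp: infdist_nonneg)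
      then have "convex_on {t - \<delta><..<t + \<delta>} (\<lambda>t. F (x + t *\<^sub>R u))"
        by (rule convex_on_cong) (use \<delta>(2) in \<open>simp add: F_def\<close>)
      with \<delta>(1) show ?thesis by blast
    next
      case False
      then have "x + t *\<^sub>R u \<in> W" by (rule cover)
      then obtain \<delta> where \<delta>: "\<delta> > 0" "\<And>s. s \<in> {t - \<delta><..<t + \<delta>} \<Longrightarrow> x + s *\<^sub>R u \<in> W"
        by (rule open_line_interval [OF \<open>open W\<close>]) blast
      have "convex_on {t - \<delta><..<t + \<delta>} (\<lambda>t. f0 (x + t *\<^sub>R u))"
        using u by (intro f0_line) auto
      then have "convex_on {t - \<delta><..<t + \<delta>} (\<lambda>t. F (x + t *\<^sub>R u))"
        by (rule convex_on_cong) (use \<delta>(2) in \<open>simp add: FW\<close>)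
      with \<delta>(1) show ?thesis by blast
    qed
  qed
  moreover have "F \<eta> \<le> 0" if "\<eta> \<in> E" for \<eta>
  proof -
    have "\<eta> \<in> U" using that subset_Rco_f [of E] U(3) by blast
    then have "?h \<eta> \<le> infdist \<eta> E"
      by (intro laminate_envelope_le infdist_nonneg)
    then show ?thesis
      using that f0(2) by (simp add: F_def)
  qed
  ultimately have "F \<xi> \<le> 0"
    using \<xi> by (auto simp: Rco_f_def)
  with \<xi> U(3) show ?thesis
    by (auto simp: F_def)
qed

text \<open>The constant function \<open>1\<close> is an admissible competitor. This rules out
  \<open>E = {}\<close> when \<open>Rco_f E\<close> has a point, a case in which
  \<open>infdist\<close> would be constantly \<open>0\<close>.\<close>

lemma Rco_f_empty: "Rco_f {} = {}"
proof -
  have "\<xi> \<notin> Rco_f {}" for \<xi> :: "real ^ 'a ^ 'b"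
  proof
    assume "\<xi> \<in> Rco_f {}"
    then have "(1::real) \<le> 0"
      unfolding Rco_f_def mem_Collect_eq using rank_one_convex_const [of 1]
      by (metis empty_iff)
    then show False by simp
  qed
  then show ?thesis by blast
qed

text \<open>Markov's inequality: the envelope is at most \<open>0\<close>, so some laminate has
  average distance to \<open>E\<close> less than \<open>\<epsilon> * \<epsilon>\<close>. The members
  outside the neighbourhood have distance at least \<open>\<epsilon>\<close>, hence total weight
  less than \<open>\<epsilon>\<close>.\<close>

lemma satisfies_H_of_mem_Rco_f:
  fixes E U :: "(real ^ 'n ^ 'm) set"
  assumes U: "open U" "bounded U" "Rco_f E \<subseteq> U" and \<xi>: "\<xi> \<in> Rco_f E" and \<epsilon>: "\<epsilon> > 0"
  shows "\<exists>I lam \<xi>s. I \<ge> 1 \<and> (\<forall>i\<in>{1..I}. lam i > 0) \<and> (\<Sum>i=1..I. lam i) = 1 \<and>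
    satisfies_H I U lam \<xi>s \<and> \<xi> = (\<Sum>i=1..I. lam i *\<^sub>R \<xi>s i) \<and>
    (\<Sum>i\<in>{i\<in>{1..I}. \<xi>s i \<notin> dist_nbhd \<epsilon> E}. lam i) < \<epsilon>"
proof -
  \<comment> \<open>Without this, a point outside \<open>dist_nbhd \<epsilon> E\<close> could have
    \<open>infdist\<close> equal to \<open>0\<close>.\<close>
  have "E \<noteq> {}" using \<xi> Rco_f_empty by auto
  have "\<xi> \<in> U" using \<xi> U(3) by blast
  have "laminate_envelope U (\<lambda>x. infdist x E) \<xi> < \<epsilon> * \<epsilon>"
    using laminate_envelope_le_0 [OF U \<xi>] \<epsilon> by (smt (verit) mult_pos_pos)
  then obtain M where M: "laminate U \<xi> M" "weighted_sum (\<lambda>x. infdist x E) M < \<epsilon> * \<epsilon>"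
    by (rule ex_laminate_weighted_sum_less [OF infdist_nonneg \<open>\<xi> \<in> U\<close>])
  obtain I lam \<xi>s where I: "I \<ge> 1" "satisfies_H I U lam \<xi>s" "\<And>i. i \<in> {1..I} \<Longrightarrow> 0 < lam i"
    "(\<Sum>i=1..I. lam i) = 1" "\<xi> = (\<Sum>i=1..I. lam i *\<^sub>R \<xi>s i)"
    and mean: "\<And>g. (\<Sum>i=1..I. lam i * g (\<xi>s i)) = weighted_sum g M"
    by (rule laminate_imp_satisfies_H [OF M(1)]) blast
  have "\<epsilon> * (\<Sum>i\<in>{i\<in>{1..I}. \<xi>s i \<notin> dist_nbhd \<epsilon> E}. lam i)
      = (\<Sum>i\<in>{i\<in>{1..I}. \<xi>s i \<notin> dist_nbhd \<epsilon> E}. lam i * \<epsilon>)"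
    by (simp add: sum_distrib_left mult.commute)
  also have "\<dots> \<le> (\<Sum>i\<in>{i\<in>{1..I}. \<xi>s i \<notin> dist_nbhd \<epsilon> E}. lam i * infdist (\<xi>s i) E)"
    using I(3) \<open>E \<noteq> {}\<close> by (intro sum_mono mult_left_mono) (auto simp: dist_nbhd_def less_imp_le)
  also have "\<dots> \<le> (\<Sum>i=1..I. lam i * infdist (\<xi>s i) E)"
    using I(3) by (intro sum_mono2) (auto simp: infdist_nonneg less_imp_le)
  also have "\<dots> < \<epsilon> * \<epsilon>"
    using M(2) mean [of "\<lambda>x. infdist x E"] by simp
  finally have "(\<Sum>i\<in>{i\<in>{1..I}. \<xi>s i \<notin> dist_nbhd \<epsilon> E}. lam i) < \<epsilon>"
    using \<epsilon> by simp
  with I show ?thesis by blast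
qed

theorem theorem2p8:
  fixes E U :: "(real ^ 'n ^ 'm) set"
  assumes "compact E" and "open U" and "bounded U" and "Rco_f E \<subseteq> U"
  shows "Rco_f E =
    {\<xi>. \<forall>\<epsilon>>0. \<exists>(I::nat) (lam::nat \<Rightarrow> real) (\<xi>s::nat \<Rightarrow> real ^ 'n ^ 'm).
        I \<ge> 1 \<and> (\<forall>i\<in>{1..I}. lam i > 0) \<and> (\<Sum>i=1..I. lam i) = 1 \<and>
        satisfies_H I U lam \<xi>s \<and>
        \<xi> = (\<Sum>i=1..I. lam i *\<^sub>R \<xi>s i) \<and>
        (\<Sum>i\<in>{i\<in>{1..I}. \<xi>s i \<notin> dist_nbhd \<epsilon> E}. lam i) < \<epsilon>}"
    (is "_ = {\<xi>. \<forall>\<epsilon>>0. ?approx \<epsilon> \<xi>}")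
proof (intro equalityI subsetI CollectI allI impI)
  fix \<xi> and \<epsilon> :: real
  assume "\<xi> \<in> Rco_f E" "\<epsilon> > 0"
  then show "?approx \<epsilon> \<xi>"
    using assms by (intro satisfies_H_of_mem_Rco_f) auto
next
  fix \<xi>
  assume "\<xi> \<in> {\<xi>. \<forall>\<epsilon>>0. ?approx \<epsilon> \<xi>}"
  then have approx: "?approx \<epsilon> \<xi>" if "\<epsilon> > 0" for \<epsilon>
    using that by blast
  show "\<xi> \<in> Rco_f E"
    unfolding Rco_f_def
  proof (intro CollectI allI impI, elim conjE)
    fix f :: "real ^ 'n ^ 'm \<Rightarrow> real"
    assume f: "rank_one_convex f" "\<forall>\<eta>\<in>E. f \<eta> \<le> 0"
    show "f \<xi> \<le> 0"
    proof (rule rank_one_convex_le_0_of_satisfies_H [OF assms(1,3) f(1)])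
      show "f \<eta> \<le> 0" if "\<eta> \<in> E" for \<eta>
        using f(2) that by blast
    next
      fix \<epsilon> :: real
      assume "\<epsilon> > 0"
      from approx [OF this] show "\<exists>I lam \<xi>s. (\<forall>i\<in>{1..I}. lam i > 0) \<and> (\<Sum>i=1..I. lam i) = 1 \<and>
        satisfies_H I U lam \<xi>s \<and> \<xi> = (\<Sum>i=1..I. lam i *\<^sub>R \<xi>s i) \<and>
        (\<Sum>i\<in>{i\<in>{1..I}. \<xi>s i \<notin> dist_nbhd \<epsilon> E}. lam i) < \<epsilon>"
        by (elim ex_forward) (erule conjunct2)
    qed
  qed
qed

end
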